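(* (a) Assume Conjecture A (stated in the context). Then for each $b\in\{3,4\}$ and every positive integer $t$ there exists a positive integer $n$ with $\nu_b^*(n)\geq t$; that is, there are integers of arbitrarily large persistence for $S_3^*$ and for $S_4^*$. (b) Assume Conjecture B (stated in the context). Then for every integer $b\geq 5$ and every positive integer $t$ there exists a positive integer $n$ with $\nu_b^*(n)\geq t$.
   Context: Fix an integer base $b\geq 2$. Every nonnegative integer $n$ has a base-$b$ expansion $n=\sum_{i=0}^k d_ib^i$ with $0\le d_i\le b-1$ and $d_k>0$. The Erdős–Sloane map is $S_b^*(n)=\prod_{0\le i\le k,\ d_i\neq 0} d_i$ (the product of the nonzero base-$b$ digits of $n$). For a map $f:\mathbb{N}\to\mathbb{N}$, $f^0(n)=n$ and $f^k(n)=f(f^{k-1}(n))$. The persistence $\nu_b^*(n)$ is the smallest $k\ge 0$ such that $f^k(n)$ is a periodic point of $f=S_b^*$ (i.e. the number of iterations needed to reach a fixed point or cycle); the periodic points of $S_b^*$ are exactly the fixed points $1,\dots,b-1$. For a base $q$, a digit $d\in\{0,\dots,q-1\}$ and a positive integer $n$, $\#d(n)_q$ is the number of occurrences of $d$ in the base-$q$ expansion of $n$ and $\#(n)_q$ is the number of base-$q$ digits of $n$. Given $\varepsilon>0$, $n$ is $\varepsilon$-equidistributed in base $q$ if $\left|\frac{\#d(n)_q}{\#(n)_q}-\frac1q\right|<\varepsilon$ for every $d\in\{0,\dots,q-1\}$. Conjecture A: For every integer $q>1$, every finite set $F$ of primes that does not contain all primes dividing $q$, and every positive integer $a$, if $(N_i)_{i\ge0}$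 is a sequence with $N_0=a$ and $N_{k+1}=N_k p_k$ with $p_k\in F$ for all $k\ge 0$, then for every $\varepsilon>0$ there is $n_0$ such that $N_n$ is $\varepsilon$-equidistributed in base $q$ for all $n\ge n_0$. Conjecture B: For every integer $q>1$, every finite set $F=\{p_1,\dots,p_k\}$ of primes that does not contain all primes dividing $q$, and every positive integer $a$, for every $\varepsilon>0$ there exists $N$ such that $a\prod_{i=1}^k p_i^{\alpha_i}$ (with nonnegative integers $\alpha_i$) is $\varepsilon$-equidistributed in base $q$ whenever $\alpha_i\ge N$ for some $i\in\{1,\dots,k\}$. *)

theory Defs
  imports Complex_Main "HOL-Library.Log_Nat" "HOL-Computational_Algebra.Primes"
begin

text \<open>For \<open>b > 1\<close> and \<open>n > 0\<close>, \<open>floorlog b n\<close> is the number of base-\<open>b\<close> digits of \<open>n\<close>, so the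
  digits of \<open>n\<close> are the \<open>digit b n i\<close> with \<open>i < floorlog b n\<close>. As \<open>floorlog b 0 = 0\<close>, the number
  \<open>0\<close> has the empty expansion and \<open>erdos_sloane b 0 = 1\<close>.\<close>

definition digit :: "nat \<Rightarrow> nat \<Rightarrow> nat \<Rightarrow> nat" where
  "digit b n i = (n div b ^ i) mod b"

definition erdos_sloane :: "nat \<Rightarrow> nat \<Rightarrow> nat" where
  "erdos_sloane b n = (\<Prod>i \<in> {i. i < floorlog b n \<and> digit b n i \<noteq> 0}. digit b n i)"

definition periodic_point :: "('a \<Rightarrow> 'a) \<Rightarrow> 'a \<Rightarrow> bool" where
  "periodic_point f x \<longleftrightarrow> (\<exists>m>0. (f ^^ m) x = x)"

definition persistence :: "nat \<Rightarrow> nat \<Rightarrow> nat" where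
  "persistence b n = (LEAST k. periodic_point (erdos_sloane b) ((erdos_sloane b ^^ k) n))"

definition digit_count :: "nat \<Rightarrow> nat \<Rightarrow> nat \<Rightarrow> nat" where
  "digit_count q d n = card {i. i < floorlog q n \<and> digit q n i = d}"

definition equidistributed :: "real \<Rightarrow> nat \<Rightarrow> nat \<Rightarrow> bool" where
  "equidistributed \<epsilon> q n \<longleftrightarrow>
     (\<forall>d<q. \<bar>real (digit_count q d n) / real (floorlog q n) - 1 / real q\<bar> < \<epsilon>)"

definition conjecture_A :: bool where
  "conjecture_A \<longleftrightarrow>
     (\<forall>(q::nat) (F::nat set) (a::nat).
        q > 1 \<and> finite F \<and> (\<forall>p\<in>F. prime p) \<and> \<not> {p. prime p \<and> p dvd q} \<subseteq> F \<and> a > 0 \<longrightarrow>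
        (\<forall>(N::nat \<Rightarrow> nat) (p::nat \<Rightarrow> nat).
           N 0 = a \<and> (\<forall>k. p k \<in> F \<and> N (Suc k) = N k * p k) \<longrightarrow>
           (\<forall>\<epsilon>>0. \<exists>n\<^sub>0. \<forall>n\<ge>n\<^sub>0. equidistributed \<epsilon> q (N n))))"

definition conjecture_B :: bool where
  "conjecture_B \<longleftrightarrow>
     (\<forall>(q::nat) (F::nat set) (a::nat).
        q > 1 \<and> finite F \<and> (\<forall>p\<in>F. prime p) \<and> \<not> {p. prime p \<and> p dvd q} \<subseteq> F \<and> a > 0 \<longrightarrow>
        (\<forall>\<epsilon>>0. \<exists>N. \<forall>\<alpha>::nat \<Rightarrow> nat.
           (\<exists>p\<in>F. \<alpha> p \<ge> N) \<longrightarrow> equidistributed \<epsilon> q (a * (\<Prod>p\<in>F. p ^ \<alpha> p))))"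

end

theory Submission
  imports Defs
begin

text \<open>Fix a prime \<open>r\<close> dividing \<open>b - 1\<close>. Removing the factors \<open>b\<close> from a number \<open>n\<close> all of whose
  primes are below \<open>b\<close> only deletes trailing zeros, does not change the exponent \<open>v\<close> of \<open>r\<close> in
  \<open>n\<close>, and leaves some prime of \<open>b\<close> with one of finitely many exponents. So the conjecture applies
  to what is left, and for large \<open>v\<close> a fixed proportion of its digits equals \<open>b - 1\<close>. Hence
  \<open>erdos_sloane b n\<close> again has all its primes below \<open>b\<close>, and its \<open>r\<close>-exponent is at least
  \<open>v / (2 b\<^sup>2)\<close>. Starting with \<open>v\<close> large enough keeps any given number of iterates above \<open>b\<close>, where
  the map is strictly decreasing and so has no periodic points.\<close>

section \<open>The digit product\<close>

lemma floorlog_rec: "b > 1 \<Longrightarrow> n > 0 \<Longrightarrow> floorlog b n = Suc (floorlog b (n div b))"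
  by (simp add: compute_floorlog)

lemma digit_0: "digit b n 0 = n mod b"
  by (simp add: digit_def)

lemma digit_Suc: "digit b n (Suc i) = digit b (n div b) i"
  by (simp add: digit_def div_mult2_eq)

lemma erdos_sloane_prod:
  "erdos_sloane b n = (\<Prod>i<floorlog b n. if digit b n i \<noteq> 0 then digit b n i else 1)"
  unfolding erdos_sloane_def by (rule prod.mono_neutral_cong_left) auto

lemma erdos_sloane_0: "erdos_sloane b 0 = 1"
  by (simp add: erdos_sloane_def floorlog_def)

lemma erdos_sloane_rec:
  assumes "b > 1" "n > 0"
  shows "erdos_sloane b n = (if n mod b \<noteq> 0 then n mod b else 1) * erdos_sloane b (n div b)"
  unfolding erdos_sloane_prod floorlog_rec[OF assms] prod.lessThan_Suc_shift digit_0 digit_Suc ..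

lemma erdos_sloane_pos: "erdos_sloane b n > 0"
  unfolding erdos_sloane_prod by (rule prod_pos) auto

text \<open>With \<open>q = n div b\<close>, the last digit contributes a factor of at most
  \<open>b - 1\<close>, and by induction the digits of \<open>q\<close> contribute at most
  \<open>q\<close>. If \<open>q > 0\<close>, the product is thus at most
  \<open>(b - 1) * q < b * q \<le> n\<close>.\<close>

lemma erdos_sloane_le:
  assumes b: "b > 1" and "n > 0"
  shows "erdos_sloane b n \<le> n \<and> (b \<le> n \<longrightarrow> erdos_sloane b n < n)"
  using \<open>n > 0\<close>
proof (induction n rule: less_induct)
  case (less n)
  show ?case
  proof (cases "n < b")
    case True
    then show ?thesis
      using less.prems b by (simp add: erdos_sloane_rec erdos_sloane_0)
  next
    case False
    let ?q = "n div b"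
    have q: "?q > 0" "?q < n"
      using False b less.prems by (auto simp: div_greater_zero_iff)
    have "n mod b < b"
      using b by simp
    then have "(if n mod b \<noteq> 0 then n mod b else 1) \<le> b - 1"
      using b by (auto simp del: mod_less_divisor)
    then have "erdos_sloane b n \<le> (b - 1) * ?q"
      unfolding erdos_sloane_rec[OF b less.prems]
      using less.IH[OF q(2) q(1)] by (intro mult_mono) auto
    also have "\<dots> < b * ?q"
      using b q by simp
    also have "\<dots> \<le> n"
      by simp
    finally show ?thesis
      by simp
  qed
qed

section \<open>Iterates, periodic points and persistence\<close>

lemma funpow_erdos_sloane_le:
  assumes "b > 1" "n > 0"
  shows "(erdos_sloane b ^^ m) n > 0 \<and> (erdos_sloane b ^^ m) n \<le> n"
proof (induction m)
  case (Suc m)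
  then show ?case
    using erdos_sloane_le[OF assms(1), of "(erdos_sloane b ^^ m) n"] by (auto simp: erdos_sloane_pos)
qed (use assms in simp)

text \<open>The first step drops strictly below \<open>n\<close>, and later iterates never climb
  back.\<close>

lemma not_periodic_point_erdos_sloane:
  assumes "b > 1" "b \<le> n"
  shows "\<not> periodic_point (erdos_sloane b) n"
proof
  assume "periodic_point (erdos_sloane b) n"
  then obtain m where "m > 0" "(erdos_sloane b ^^ m) n = n"
    unfolding periodic_point_def by blast
  then obtain k where "(erdos_sloane b ^^ k) (erdos_sloane b n) = n"
    by (metis comp_apply funpow_Suc_right gr0_implies_Suc)
  moreover have "erdos_sloane b n < n"
    using erdos_sloane_le[of b n] assms by simp
  ultimately show False
    using funpow_erdos_sloane_le[OF assms(1) erdos_sloane_pos, of k b n] by simp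
qed

lemma periodic_point_fixed: "f x = x \<Longrightarrow> periodic_point f x"
  unfolding periodic_point_def by (rule exI[of _ 1]) simp

text \<open>This makes the \<open>LEAST\<close> in \<open>persistence\<close> meaningful: on
  positive numbers the map never increases, so descent ends at a fixed point.\<close>

lemma ex_periodic_point_erdos_sloane:
  assumes b: "b > 1"
  shows "\<exists>k. periodic_point (erdos_sloane b) ((erdos_sloane b ^^ k) n)"
proof (induction n rule: less_induct)
  case (less n)
  consider "n = 0" | "n > 0" "erdos_sloane b n = n" | "erdos_sloane b n < n"
    using erdos_sloane_le[OF b, of n] by fastforce
  then show ?case
  proof cases
    case 1
    \<comment> \<open>The number 0 is the one argument that increases: its empty product sends it to
      the fixed point 1.\<close>
    have "erdos_sloane b 1 = 1"
      using erdos_sloane_le[OF b, of 1] erdos_sloane_pos[of b 1] by simp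
    then have "periodic_point (erdos_sloane b) ((erdos_sloane b ^^ 1) n)"
      using 1 by (simp add: erdos_sloane_0 periodic_point_fixed)
    then show ?thesis ..
  next
    case 2
    then have "periodic_point (erdos_sloane b) ((erdos_sloane b ^^ 0) n)"
      by (simp add: periodic_point_fixed)
    then show ?thesis ..
  next
    case 3
    then obtain k where "periodic_point (erdos_sloane b) ((erdos_sloane b ^^ k) (erdos_sloane b n))"
      using less.IH by blast
    then have "periodic_point (erdos_sloane b) ((erdos_sloane b ^^ Suc k) n)"
      by (simp only: funpow_Suc_right comp_apply)
    then show ?thesis ..
  qed
qed

lemma persistence_geI:
  assumes b: "b > 1" and large: "\<And>k. k < t \<Longrightarrow> b \<le> (erdos_sloane b ^^ k) n"
  shows "t \<le> persistence b n"
proof (rule ccontr)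
  assume "\<not> t \<le> persistence b n"
  moreover have "periodic_point (erdos_sloane b) ((erdos_sloane b ^^ persistence b n) n)"
    unfolding persistence_def by (rule LeastI_ex[OF ex_periodic_point_erdos_sloane[OF b]])
  ultimately show False
    using large not_periodic_point_erdos_sloane[OF b] by simp
qed

section \<open>Divisibility of digit products and digit counts\<close>

lemma prime_dvd_erdos_sloane_less:
  assumes "b > 1" "prime p" "p dvd erdos_sloane b n"
  shows "p < b"
proof -
  obtain i where "digit b n i \<noteq> 0" "p dvd digit b n i"
    using assms(2,3) unfolding erdos_sloane_def by (auto simp: prime_dvd_prod_iff)
  then show ?thesis
    using dvd_imp_le[of p "digit b n i"] assms(1) mod_less_divisor[of b "n div b ^ i"]
    by (simp add: digit_def order_le_less_trans)
qed

lemma power_digit_count_dvd_erdos_sloane: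
  assumes "d > 0"
  shows "d ^ digit_count b d n dvd erdos_sloane b n"
proof -
  have "d ^ digit_count b d n = (\<Prod>i \<in> {i. i < floorlog b n \<and> digit b n i = d}. digit b n i)"
    by (simp add: digit_count_def)
  also have "\<dots> dvd erdos_sloane b n"
    unfolding erdos_sloane_def using assms by (intro prod_dvd_prod_subset) auto
  finally show ?thesis .
qed

text \<open>Multiplying by \<open>b\<close> moves every digit up one place, so \<open>Suc\<close>
  injects the positions of \<open>d\<close>. Only an inequality holds in general, since the appended
  zero counts when \<open>d = 0\<close>.\<close>

lemma digit_count_le_mult_base:
  assumes "b > 1" "m > 0"
  shows "digit_count b d m \<le> digit_count b d (b * m)"
  unfolding digit_count_def
  by (rule card_inj_on_le[of Suc]) (use assms in \<open>auto simp: digit_Suc floorlog_rec[of b "b * m"]\<close>)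

lemma digit_count_le_mult_base_power:
  assumes "b > 1" "m > 0"
  shows "digit_count b d m \<le> digit_count b d (b ^ e * m)"
proof (induction e)
  case (Suc e)
  then show ?case
    using digit_count_le_mult_base[OF assms(1), of "b ^ e * m" d] assms
    by (simp add: mult.assoc)
qed simp

section \<open>Growth of exponents under equidistribution\<close>

text \<open>The crude bound \<open>b \<le> 2 ^ b\<close> avoids logarithms: \<open>m\<close> lies
  below \<open>2 ^ (b * floorlog b m)\<close>.\<close>

lemma less_base_mult_floorlog:
  assumes "b > 1" "2 ^ v \<le> m"
  shows "v < b * floorlog b m"
proof -
  have m: "m > 0"
    using assms(2) by (metis gr0I not_one_le_zero one_le_numeral one_le_power order_trans)
  have "m < b ^ floorlog b m"
    using floorlog_bounds[of m b] assms m by simp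
  also have "\<dots> \<le> (2 ^ b) ^ floorlog b m"
    by (simp add: power_mono)
  finally have "(2::nat) ^ v < 2 ^ (b * floorlog b m)"
    using assms(2) by (simp add: power_mult)
  then show ?thesis
    by simp
qed

text \<open>The tolerance is half of \<open>1 / b\<close>, so each digit still has frequency above
  \<open>1 / (2 * b)\<close>. Since \<open>m\<close> has more than \<open>v / b\<close> digits, the
  constant \<open>2 * b ^ 2\<close> results.\<close>

lemma digit_count_lower_bound:
  assumes b: "b > 1" and eq: "equidistributed (1 / (2 * real b)) b m" and "d < b" and m: "2 ^ v \<le> m"
  shows "v \<le> 2 * b\<^sup>2 * digit_count b d m"
proof -
  let ?L = "real (floorlog b m)" and ?c = "real (digit_count b d m)"
  have v: "v < b * floorlog b m"
    using less_base_mult_floorlog[OF b m] .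
  then have L: "?L > 0"
    by (cases "floorlog b m") auto
  have "\<bar>?c / ?L - 1 / real b\<bar> < 1 / (2 * real b)"
    using eq \<open>d < b\<close> by (simp add: equidistributed_def)
  then have "1 / (2 * real b) < ?c / ?L"
    by (simp add: field_simps abs_if split: if_splits)
  then have "?L < 2 * real b * ?c"
    using L b by (simp add: field_simps)
  then have "floorlog b m < 2 * b * digit_count b d m"
    by (metis of_nat_less_iff of_nat_mult of_nat_numeral)
  then have "b * floorlog b m \<le> b * (2 * b * digit_count b d m)"
    by (intro mult_le_mono2) simp
  then show ?thesis
    using v by (simp only: power2_eq_square mult_ac)
qed

text \<open>The instance of Conjecture B for base \<open>b\<close> in which the exponent of \<open>r\<close> is the large one. For
  \<open>b \<in> {3, 4}\<close> its set of primes is the singleton \<open>{b - 1}\<close>, which is why Conjecture A suffices.\<close>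

definition smooth_equidistribution :: "nat \<Rightarrow> nat \<Rightarrow> bool" where
  "smooth_equidistribution b r \<longleftrightarrow>
     (\<forall>s a. prime s \<and> s dvd b \<and> a > 0 \<longrightarrow>
        (\<forall>\<epsilon>>0. \<exists>N. \<forall>\<alpha>::nat \<Rightarrow> nat. N \<le> \<alpha> r \<longrightarrow>
           equidistributed \<epsilon> b (a * (\<Prod>p | prime p \<and> p < b \<and> p \<noteq> s. p ^ \<alpha> p))))"

text \<open>The power of \<open>s\<close> is split off to serve as the fixed factor \<open>a\<close>
  of \<open>smooth_equidistribution\<close>, while the remaining exponents stay free.\<close>

lemma smooth_factorization:
  fixes m s b :: nat
  assumes "m > 0" "prime s" "s \<le> b" and smooth: "\<And>p. prime p \<Longrightarrow> p dvd m \<Longrightarrow> p < b"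
  shows "m = s ^ multiplicity s m * (\<Prod>p | prime p \<and> p < b \<and> p \<noteq> s. p ^ multiplicity p m)"
proof -
  let ?F = "{p. prime p \<and> p < b \<and> p \<noteq> s}"
  have "m = (\<Prod>p\<in>prime_factors m. p ^ multiplicity p m)"
    using \<open>m > 0\<close> by (simp add: prime_factorization_nat)
  also have "\<dots> = (\<Prod>p\<in>insert s ?F. p ^ multiplicity p m)"
    by (rule prod.mono_neutral_left)
      (use assms in \<open>auto simp: prime_factors_dvd not_dvd_imp_multiplicity_0 intro: ccontr\<close>)
  also have "\<dots> = s ^ multiplicity s m * (\<Prod>p\<in>?F. p ^ multiplicity p m)"
    by (subst prod.insert) auto
  finally show ?thesis .
qed

text \<open>One application of the map costs at most a constant factor in the exponent of
  \<open>r\<close>, once that exponent is large. The threshold must depend on \<open>b\<close> and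
  \<open>r\<close> only, so that it can be used at every iterate.\<close>

lemma multiplicity_erdos_sloane_lower_bound:
  assumes b: "b > 1" and r: "prime r" "r dvd b - 1" and eq: "smooth_equidistribution b r"
  obtains N where "\<And>n. n > 0 \<Longrightarrow> (\<And>p. prime p \<Longrightarrow> p dvd n \<Longrightarrow> p < b) \<Longrightarrow> N \<le> multiplicity r n \<Longrightarrow>
    multiplicity r n \<le> 2 * b\<^sup>2 * multiplicity r (erdos_sloane b n)"
proof -
  have r_b: "\<not> r dvd b"
  proof
    assume "r dvd b"
    then have "r dvd b - (b - 1)"
      using r(2) by (rule dvd_diff_nat)
    then show False
      using b r(1) by simp
  qed
  define P where "P = prime_factors b"
  define Q where "Q N s k \<longleftrightarrow> (\<forall>\<alpha>::nat \<Rightarrow> nat. N \<le> \<alpha> r \<longrightarrow> equidistributed (1 / (2 * real b)) b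
    (s ^ k * (\<Prod>p | prime p \<and> p < b \<and> p \<noteq> s. p ^ \<alpha> p)))" for N s k
  have "\<exists>N. Q N s k" if "s \<in> P" for s k
  proof -
    have "prime s" "s dvd b"
      using that by (auto simp: P_def)
    moreover from this have "s ^ k > 0"
      by (simp add: prime_gt_0_nat)
    moreover have "1 / (2 * real b) > 0"
      using b by simp
    ultimately show ?thesis
      using eq unfolding smooth_equidistribution_def Q_def by blast
  qed
  then obtain N where N: "\<And>s k. s \<in> P \<Longrightarrow> Q (N s k) s k"
    by metis
  \<comment> \<open>Finitely many pairs \<open>s\<close>, \<open>k\<close> can occur, and the sum
    dominates each of their thresholds.\<close>
  define M where "M = (\<Sum>s\<in>P. \<Sum>k<multiplicity s b. N s k)"
  show ?thesis
  proof (rule that[of M])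
    fix n
    assume n: "n > 0" and smooth: "\<And>p. prime p \<Longrightarrow> p dvd n \<Longrightarrow> p < b" and M: "M \<le> multiplicity r n"
    obtain m where m: "n = b ^ multiplicity b n * m" "\<not> b dvd m"
      using multiplicity_decompose'[of n b] n b by auto
    have m0: "m > 0"
      using n m(1) by (metis gr0I mult_0_right)
    have rm: "multiplicity r n = multiplicity r m"
    proof -
      have "multiplicity r n = multiplicity r (b ^ multiplicity b n) + multiplicity r m"
        using r(1) b m0 by (subst m(1)) (auto intro!: prime_elem_multiplicity_mult_distrib)
      moreover have "multiplicity r (b ^ multiplicity b n) = 0"
        using r(1) r_b by (auto intro!: not_dvd_imp_multiplicity_0 dest: prime_dvd_power)
      ultimately show ?thesis
        by simp
    qed
    \<comment> \<open>As \<open>b\<close> does not divide \<open>m\<close>, some prime occurs less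
      often in \<open>m\<close> than in \<open>b\<close>. This bounds its exponent and singles out
      the prime to exclude.\<close>
    obtain s where s: "prime s" "multiplicity s m < multiplicity s b"
      using m(2) m0 b multiplicity_le_imp_dvd[of b m] by (metis not_le not_one_less_zero gr0I)
    have sP: "s \<in> P"
      using s b not_dvd_imp_multiplicity_0[of s b] by (fastforce simp: P_def prime_factors_dvd)
    have "N s (multiplicity s m) \<le> (\<Sum>k<multiplicity s b. N s k)"
      using s by (intro member_le_sum) auto
    also have "\<dots> \<le> M"
      unfolding M_def using sP by (intro member_le_sum) (auto simp: P_def)
    finally have "N s (multiplicity s m) \<le> multiplicity r m"
      using M rm by simp
    then have "equidistributed (1 / (2 * real b)) b
        (s ^ multiplicity s m * (\<Prod>p | prime p \<and> p < b \<and> p \<noteq> s. p ^ multiplicity p m))"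
      using N[OF sP, of "multiplicity s m", unfolded Q_def, THEN spec, of "\<lambda>p. multiplicity p m"]
      by simp
    moreover have "s \<le> b"
      using sP b by (auto simp: P_def prime_factors_dvd intro: dvd_imp_le)
    moreover have "p < b" if "prime p" "p dvd m" for p
      using smooth that m(1) by (metis dvd_mult)
    ultimately have equi: "equidistributed (1 / (2 * real b)) b m"
      using smooth_factorization[of m s b] m0 s(1) by metis
    have "2 ^ multiplicity r m \<le> r ^ multiplicity r m"
      using prime_ge_2_nat[OF r(1)] by (simp add: power_mono)
    also have "\<dots> \<le> m"
      using m0 by (intro dvd_imp_le multiplicity_dvd)
    finally have "multiplicity r m \<le> 2 * b\<^sup>2 * digit_count b (b - 1) m"
      using digit_count_lower_bound[OF b equi, of "b - 1"] b by simp
    also have "\<dots> \<le> 2 * b\<^sup>2 * digit_count b (b - 1) n"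
      using digit_count_le_mult_base_power[OF b m0, of "b - 1" "multiplicity b n"]
      by (simp flip: m(1))
    \<comment> \<open>Each digit \<open>b - 1\<close> contributes at least one factor
      \<open>r\<close>.\<close>
    also have "digit_count b (b - 1) n \<le> multiplicity r (erdos_sloane b n)"
    proof (rule multiplicity_geI)
      have "r ^ digit_count b (b - 1) n dvd (b - 1) ^ digit_count b (b - 1) n"
        using r(2) by (rule dvd_power_same)
      also have "\<dots> dvd erdos_sloane b n"
        using b by (intro power_digit_count_dvd_erdos_sloane) simp
      finally show "r ^ digit_count b (b - 1) n dvd erdos_sloane b n" .
    qed (use r(1) erdos_sloane_pos[of b n] in auto)
    finally show "multiplicity r n \<le> 2 * b\<^sup>2 * multiplicity r (erdos_sloane b n)"
      by (simp add: rm)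
  qed
qed

section \<open>Iteration and arbitrarily large persistence\<close>

lemma ex_large_iterates:
  assumes b: "b > 1" and r: "prime r" "r dvd b - 1" and eq: "smooth_equidistribution b r"
  shows "\<exists>K. \<forall>n>0. (\<forall>p. prime p \<longrightarrow> p dvd n \<longrightarrow> p < b) \<longrightarrow> K \<le> multiplicity r n \<longrightarrow>
    (\<forall>k<t. b \<le> (erdos_sloane b ^^ k) n)"
proof (induction t)
  case (Suc t)
  then obtain K where K: "\<And>n k. \<lbrakk>n > 0; \<forall>p. prime p \<longrightarrow> p dvd n \<longrightarrow> p < b; K \<le> multiplicity r n; k < t\<rbrakk>
      \<Longrightarrow> b \<le> (erdos_sloane b ^^ k) n"
    by blast
  obtain N where N: "\<And>n. n > 0 \<Longrightarrow> (\<And>p. prime p \<Longrightarrow> p dvd n \<Longrightarrow> p < b) \<Longrightarrow> N \<le> multiplicity r n \<Longrightarrow>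
      multiplicity r n \<le> 2 * b\<^sup>2 * multiplicity r (erdos_sloane b n)"
    using multiplicity_erdos_sloane_lower_bound[OF assms] by blast
  \<comment> \<open>In the threshold, \<open>N\<close> enables the growth bound, \<open>b\<close>
    gives \<open>n \<ge> 2 ^ b > b\<close> for the zeroth iterate, and \<open>2 * b ^ 2 * K\<close>
    leaves exponent at least \<open>K\<close> after one step. The induction hypothesis then applies
    to \<open>erdos_sloane b n\<close>.\<close>
  have "b \<le> (erdos_sloane b ^^ k) n"
    if n: "n > 0" "\<forall>p. prime p \<longrightarrow> p dvd n \<longrightarrow> p < b" "max N (max b (2 * b\<^sup>2 * K)) \<le> multiplicity r n"
      and k: "k < Suc t" for n k
  proof (cases k)
    case 0
    have "b \<le> 2 ^ multiplicity r n"
      using n(3) less_exp[of "multiplicity r n"] by linarith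
    also have "\<dots> \<le> r ^ multiplicity r n"
      using prime_ge_2_nat[OF r(1)] by (simp add: power_mono)
    also have "\<dots> \<le> n"
      using n(1) by (intro dvd_imp_le multiplicity_dvd)
    finally show ?thesis
      using 0 by simp
  next
    case (Suc j)
    have "2 * b\<^sup>2 * K \<le> multiplicity r n"
      using n(3) by simp
    also have "\<dots> \<le> 2 * b\<^sup>2 * multiplicity r (erdos_sloane b n)"
      using N[of n] n by simp
    finally have "K \<le> multiplicity r (erdos_sloane b n)"
      using b by simp
    then have "b \<le> (erdos_sloane b ^^ j) (erdos_sloane b n)"
      using K[of "erdos_sloane b n" j] erdos_sloane_pos prime_dvd_erdos_sloane_less[OF b] k Suc
      by simp
    then show ?thesis
      unfolding Suc by (simp only: funpow_Suc_right comp_apply)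
  qed
  then show ?case
    by blast
qed simp

text \<open>The witness is a power of \<open>r\<close>: its only possible prime divisor is below
  \<open>b\<close>, and its \<open>r\<close>-exponent can be prescribed.\<close>

lemma ex_persistence_ge:
  assumes b: "b > 1" and r: "prime r" "r dvd b - 1" and eq: "smooth_equidistribution b r"
  shows "\<exists>n>0. t \<le> persistence b n"
proof -
  obtain K where K: "\<And>n k. \<lbrakk>n > 0; \<forall>p. prime p \<longrightarrow> p dvd n \<longrightarrow> p < b; K \<le> multiplicity r n; k < t\<rbrakk>
      \<Longrightarrow> b \<le> (erdos_sloane b ^^ k) n"
    using ex_large_iterates[OF assms, of t] by blast
  have r_less: "r < b"
    using dvd_imp_le[OF r(2)] b by simp
  have "p < b" if "prime p" "p dvd r ^ K" for p
    using that r(1) r_less by (metis prime_dvd_power primes_dvd_imp_eq)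
  then have "t \<le> persistence b (r ^ K)"
    using r(1) by (intro persistence_geI[OF b] K) (auto simp: prime_gt_0_nat)
  then show ?thesis
    using r(1) prime_gt_0_nat by (intro exI[of _ "r ^ K"]) simp
qed

section \<open>Obtaining the equidistribution instance from each conjecture\<close>

lemma smooth_equidistribution_if_conjecture_B:
  assumes B: conjecture_B and b: "b > 1" and r: "prime r" "r < b" "\<not> r dvd b"
  shows "smooth_equidistribution b r"
  unfolding smooth_equidistribution_def
proof (intro allI impI)
  fix s a :: nat and \<epsilon> :: real
  assume s: "prime s \<and> s dvd b \<and> a > 0" and \<epsilon>: "\<epsilon> > 0"
  let ?F = "{p. prime p \<and> p < b \<and> p \<noteq> s}"
  \<comment> \<open>Leaving out \<open>s\<close>, a prime of \<open>b\<close>, makes the set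
    admissible; \<open>r\<close> stays in it because \<open>r\<close> does not divide
    \<open>b\<close>.\<close>
  have "finite ?F" "\<forall>p\<in>?F. prime p" "\<not> {p. prime p \<and> p dvd b} \<subseteq> ?F"
    using s by auto
  then obtain N where N: "\<And>\<alpha>::nat \<Rightarrow> nat. \<exists>p\<in>?F. \<alpha> p \<ge> N \<Longrightarrow>
      equidistributed \<epsilon> b (a * (\<Prod>p\<in>?F. p ^ \<alpha> p))"
    using B b s \<epsilon> unfolding conjecture_B_def by meson
  have "r \<in> ?F"
    using r s by auto
  then show "\<exists>N. \<forall>\<alpha>. N \<le> \<alpha> r \<longrightarrow> equidistributed \<epsilon> b (a * (\<Prod>p\<in>?F. p ^ \<alpha> p))"
    using N by blast
qed

text \<open>With a single allowed prime, the sequence in Conjecture A can only be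
  \<open>a * r ^ k\<close>, so its index is the exponent of \<open>r\<close> and the threshold is
  uniform.\<close>

lemma smooth_equidistribution_if_conjecture_A:
  assumes A: conjecture_A and b: "b > 1"
    and F: "\<And>s. prime s \<Longrightarrow> s dvd b \<Longrightarrow> {p. prime p \<and> p < b \<and> p \<noteq> s} = {r}"
  shows "smooth_equidistribution b r"
  unfolding smooth_equidistribution_def
proof (intro allI impI)
  fix s a :: nat and \<epsilon> :: real
  assume s: "prime s \<and> s dvd b \<and> a > 0" and \<epsilon>: "\<epsilon> > 0"
  have "prime r" "r \<noteq> s"
    using F[of s] s by auto
  then have "b > 1 \<and> finite {r} \<and> (\<forall>p\<in>{r}. prime p) \<and> \<not> {p. prime p \<and> p dvd b} \<subseteq> {r} \<and> a > 0"
    using b s by auto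
  then have "(\<forall>N p. N 0 = a \<and> (\<forall>k. p k \<in> {r} \<and> N (Suc k) = N k * p k) \<longrightarrow>
      (\<forall>\<epsilon>>0. \<exists>n\<^sub>0. \<forall>n\<ge>n\<^sub>0. equidistributed \<epsilon> b (N n)))"
    by (rule A[unfolded conjecture_A_def, THEN spec, THEN spec, THEN spec, THEN mp])
  from this[rule_format, of "\<lambda>k. a * r ^ k" "\<lambda>_. r", OF _ \<epsilon>]
  have "\<exists>n\<^sub>0. \<forall>n\<ge>n\<^sub>0. equidistributed \<epsilon> b (a * r ^ n)"
    by simp
  then show "\<exists>N. \<forall>\<alpha>. N \<le> \<alpha> r \<longrightarrow>
      equidistributed \<epsilon> b (a * (\<Prod>p | prime p \<and> p < b \<and> p \<noteq> s. p ^ \<alpha> p))"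
    using F[of s] s by auto
qed

theorem theorem5:
  shows "(conjecture_A \<longrightarrow>
            (\<forall>b\<in>{3, 4}. \<forall>t>0. \<exists>n>0. persistence b n \<ge> t)) \<and>
         (conjecture_B \<longrightarrow>
            (\<forall>b\<ge>5. \<forall>t>0. \<exists>n>0. persistence b n \<ge> t))"
proof (intro conjI impI ballI allI)
  fix b t :: nat
  assume A: conjecture_A and b: "b \<in> {3, 4}"
  have prime_less_4: "p = 2 \<or> p = 3" if "prime p" "p < 4" for p :: nat
    using that prime_ge_2_nat[of p] by linarith
  have "prime (b - 1)"
    using b by auto
  \<comment> \<open>For \<open>b = 3\<close> this forces \<open>s = 3\<close> and leaves 2; for
    \<open>b = 4\<close> it forces \<open>s = 2\<close> and leaves 3.\<close>
  moreover have "{p. prime p \<and> p < b \<and> p \<noteq> s} = {b - 1}" if s: "prime s" "s dvd b" for s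
  proof -
    have "s = (if b = 3 then 3 else 2)"
    proof (cases "b = 3")
      case True
      then show ?thesis
        using s primes_dvd_imp_eq[of s 3] by simp
    next
      case False
      then have "s dvd 2 ^ 2"
        using b s by simp
      then have "s dvd 2"
        using s(1) by (rule prime_dvd_power[rotated])
      then show ?thesis
        using False s(1) primes_dvd_imp_eq[of s 2] by simp
    qed
    then show ?thesis
      using b by (auto dest: prime_less_4)
  qed
  ultimately show "\<exists>n>0. persistence b n \<ge> t"
    using b by (intro ex_persistence_ge[of b "b - 1"] smooth_equidistribution_if_conjecture_A A) auto
next
  fix b t :: nat
  assume B: conjecture_B and b: "b \<ge> 5"
  obtain r where r: "prime r" "r dvd b - 1"
    using prime_factor_nat[of "b - 1"] b by force
  have "r < b"
    using dvd_imp_le[OF r(2)] b by simp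
  moreover have "\<not> r dvd b"
    using dvd_diff_nat[of r b "b - 1"] r b by auto
  ultimately show "\<exists>n>0. persistence b n \<ge> t"
    using r b by (intro ex_persistence_ge[of b r] smooth_equidistribution_if_conjecture_B B) auto
qed

end
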